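(* Let $p$ be a symmetric nc polynomial of degree $d$ in $g$ symmetric variables, let $\nu=1+g+\cdots+g^{d-2}$, and let $k$ be a positive integer. Suppose $X\in(\mathbb{R}^{n\times n}_{sym})^g$, $v\in\mathbb{R}^n$, and $\mathcal H$ is a subspace of $(\mathbb{R}^{n\times n}_{sym})^g$. If the set of vectors $\{V(X)[H]v:\ H\in\mathcal H\}$ has codimension at most $kn-1$ in $\mathbb{R}^{ng\nu}$ and if the Hessian of $p$ is positive relative to $\mathcal H$ at $(X,v)$, then $\sigma_-^{min}(p'')<k$.
   Context: An nc polynomial is an element of the free algebra $\mathbb{R}\langle x\rangle$ in noncommuting variables $x_1,\dots,x_g$ with real coefficients. The involution $T$ is the linear map with $x_j^T=x_j$ (and $h_j^T=h_j$) that reverses words; $p$ is symmetric if $p^T=p$. $(\mathbb{R}^{n\times n}_{sym})^g$ is the set of $g$-tuples of real symmetric $n\times n$ matrices, at which nc polynomials are evaluated by substitution. The Hessian $p''(x)[h]=\frac{d^2}{dt^2}p(x+th)|_{t=0}$ is an nc polynomial in the $2g$ variables $x_1,\dots,x_g,h_1,\dots,h_g$. The Hessian of $p$ is positive relative to a subspace $\mathcal H\subset(\mathbb{R}^{n\times n}_{sym})^g$ at $(X,v)$ if $\langle p''(X)[H]v,v\rangle\ge0$ for each $H\in\mathcal H$. $V(x)[h]$ is the column vector of height $g\nu$ whose entries are the polynomials $h_jm(x)$, where $1\le j\le g$ and $m$ runs over all words in $x$ of length at most $d-2$ (in some fixed order). Thus $V(X)[H]v\in\mathbb{R}^{ng\nu}$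 is the column of the vectors $H_jm(X)v\in\mathbb{R}^n$. For a symmetric nc polynomial $f$, $\sigma_-^{min}(f)$ is the smallest number $\sigma_-$ of negative squares in a representation $f=\sum_{j=1}^{\sigma_+}(f_j^+)^Tf_j^+-\sum_{\ell=1}^{\sigma_-}(f_\ell^-)^Tf_\ell^-$ with nc polynomials $f_j^+,f_\ell^-$; for $f=p''(x)[h]$ these are polynomials in $(x,h)$. *)

theory Defs
  imports "HOL-Analysis.Analysis" "HOL-Analysis.Finite_Function_Topology"
begin

text \<open>
  Words form a monoid under concatenation, written additively because \<open>Poly_Mapping\<close> convolves
  along \<open>+\<close>. With this instance, \<open>'v list \<Rightarrow>\<^sub>0 real\<close> with its library ring structure is the free
  algebra on noncommuting variables indexed by \<open>'v\<close>.
\<close>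

instantiation list :: (type) monoid_add
begin
definition zero_list :: "'a list" where "zero_list = []"
definition plus_list :: "'a list \<Rightarrow> 'a list \<Rightarrow> 'a list" where "plus_list = (@)"
instance by standard (simp_all add: zero_list_def plus_list_def)
end

type_synonym 'v ncpoly = "'v list \<Rightarrow>\<^sub>0 real"

definition nc_var :: "'v \<Rightarrow> 'v ncpoly" where
  "nc_var j = Poly_Mapping.single [j] 1"

definition nc_transpose :: "'v ncpoly \<Rightarrow> 'v ncpoly" where
  "nc_transpose = Poly_Mapping.map_key rev"

definition nc_symmetric :: "'v ncpoly \<Rightarrow> bool" where
  "nc_symmetric p \<longleftrightarrow> nc_transpose p = p"

text \<open>The zero polynomial is given degree 0.\<close>

definition nc_degree :: "'v ncpoly \<Rightarrow> nat" where
  "nc_degree p = Max (insert 0 (length ` Poly_Mapping.keys p))"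

definition nc_subst :: "('v \<Rightarrow> 'u ncpoly) \<Rightarrow> 'v ncpoly \<Rightarrow> 'u ncpoly" where
  "nc_subst a p = (\<Sum>w\<in>Poly_Mapping.keys p. Poly_Mapping.lookup p w *\<^sub>R prod_list (map a w))"

text \<open>Matrices need a separate evaluation because \<open>*\<close> on \<open>real^'n^'n\<close> is the entrywise product.\<close>

definition word_eval :: "('v \<Rightarrow> real^'n^'n) \<Rightarrow> 'v list \<Rightarrow> real^'n^'n" where
  "word_eval A w = foldr (\<lambda>j M. A j ** M) w (mat 1)"

definition nc_eval :: "('v \<Rightarrow> real^'n^'n) \<Rightarrow> 'v ncpoly \<Rightarrow> real^'n^'n" where
  "nc_eval A p = (\<Sum>w\<in>Poly_Mapping.keys p. Poly_Mapping.lookup p w *\<^sub>R word_eval A w)"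

text \<open>
  In the variables \<open>(x, h)\<close>, \<open>Inl j\<close> stands for \<open>x\<^sub>j\<close> and \<open>Inr j\<close> for \<open>h\<^sub>j\<close>. The derivatives are
  taken in the normed space of nc polynomials; the curve \<open>p(x + th)\<close> is polynomial in \<open>t\<close> and stays
  in a finite-dimensional subspace, so they are the coefficientwise derivatives.
\<close>

definition nc_Hessian :: "'g ncpoly \<Rightarrow> ('g + 'g) ncpoly" where
  "nc_Hessian p =
     vector_derivative
       (\<lambda>s. vector_derivative
              (\<lambda>t. nc_subst (\<lambda>j. nc_var (Inl j) + t *\<^sub>R nc_var (Inr j)) p) (at s))
       (at 0)"

definition sym_tuples :: "((real^'n^'n)^'g) set" where
  "sym_tuples = {X. \<forall>j. transpose (X $ j) = X $ j}"

definition Hessian_positive_rel ::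
    "'g::finite ncpoly \<Rightarrow> ((real^'n^'n)^'g) set \<Rightarrow> (real^'n^'n)^'g \<Rightarrow> real^'n \<Rightarrow> bool" where
  "Hessian_positive_rel p \<H> X v \<longleftrightarrow>
     (\<forall>H\<in>\<H>. (nc_eval (case_sum (($) X) (($) H)) (nc_Hessian p) *v v) \<bullet> v \<ge> 0)"

text \<open>
  Coordinate \<open>(j, m)\<close> of the border vector is the block \<open>H\<^sub>j m(X) v\<close>. The polynomial mappings
  supported on these index pairs form a copy of the space \<open>\<real>\<close> to the power \<open>n g \<nu>\<close>.
  The bound \<open>length m + 2 \<le> d\<close> avoids truncated subtraction: there are no such words if \<open>d < 2\<close>.
\<close>

definition border_index :: "nat \<Rightarrow> ('g::finite \<times> 'g list) set" where
  "border_index d = {(j, m). length m + 2 \<le> d}"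

definition border_vector ::
    "nat \<Rightarrow> (real^'n^'n)^'g \<Rightarrow> (real^'n^'n)^'g \<Rightarrow> real^'n \<Rightarrow> ('g::finite \<times> 'g list) \<Rightarrow>\<^sub>0 real^'n" where
  "border_vector d X H v =
     (\<Sum>(j, m)\<in>border_index d.
        Poly_Mapping.single (j, m) ((H $ j) *v (word_eval (($) X) m *v v)))"

definition is_SDS :: "'v ncpoly \<Rightarrow> nat \<Rightarrow> nat \<Rightarrow> bool" where
  "is_SDS f r s \<longleftrightarrow>
     (\<exists>(fp :: nat \<Rightarrow> 'v ncpoly) (fm :: nat \<Rightarrow> 'v ncpoly).
        f = (\<Sum>j<r. nc_transpose (fp j) * fp j) - (\<Sum>l<s. nc_transpose (fm l) * fm l))"

text \<open>
  The minimum is over a nonempty set whenever \<open>f\<close> is symmetric, since then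
  \<open>4 f = (f + 1)\<^sup>T (f + 1) - (f - 1)\<^sup>T (f - 1)\<close>.
\<close>

definition sigma_minus_min :: "'v ncpoly \<Rightarrow> nat" where
  "sigma_minus_min f = (LEAST s. \<exists>r. is_SDS f r s)"

end

theory Submission
  imports Defs
begin

text \<open>
  Let \<open>\<phi>\<^sub>0, \<phi>\<^sub>1, \<dots>\<close> be the Taylor coefficients of \<open>(1 - z)\<close> to the power \<open>-1/2\<close>, so that
  \<open>\<Sum>a\<le>n. \<phi>\<^sub>a \<phi>\<^sub>n\<^sub>-\<^sub>a = 1\<close> for every \<open>n\<close>. For a word \<open>u\<close> let \<open>W\<^sub>u\<close> be the sum over the positions \<open>a\<close> of \<open>u\<close> of
  \<open>\<phi>\<^sub>a\<close> times \<open>u\<close> with its letter \<open>x\<close> at position \<open>a\<close> replaced by \<open>h\<close>. Cutting every word of \<open>p\<close> in all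
  possible ways into two non-empty pieces, \<open>rev u\<close> and \<open>u'\<close>, gives the exact formula
  \<open>p'' = \<Sum>u u'. Q u u' W\<^sub>u\<^sup>T W\<^sub>u\<^sub>'\<close> where \<open>Q u u'\<close> is twice the coefficient of \<open>rev u @ u'\<close> in \<open>p\<close>, because a pair of
  positions \<open>s < t\<close> is hit by the cuts between them with total weight 1. Diagonalizing \<open>Q\<close> writes \<open>p''\<close>
  as a signed sum of squares with as many negative squares as \<open>Q\<close> has negative directions, \<open>N\<close> say.

  On matrices, the vector of all \<open>W\<^sub>u(X)[H]v\<close> is the image of the border vector under a unitriangular,
  hence injective, map. So these vectors form a space of codimension at most \<open>kn - 1\<close>, on which
  \<open>Q \<otimes> I\<^sub>n\<close> is positive semidefinite, while \<open>Q \<otimes> I\<^sub>n\<close> is negative definite on a space of dimension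
  \<open>N n\<close>. If \<open>N \<ge> k\<close>, the two spaces meet in a non-zero vector, which is impossible.
\<close>

subsection \<open>Polynomial mappings and the free algebra\<close>

lemma lookup_scaleR: "Poly_Mapping.lookup (c *\<^sub>R f) i = c *\<^sub>R Poly_Mapping.lookup f i"
proof -
  have "finite {i. c *\<^sub>R Poly_Mapping.lookup f i \<noteq> 0}"
    by (rule finite_subset[OF _ finite_lookup[of f]]) auto
  then show ?thesis
    by (simp add: scaleR_poly_mapping_def)
qed

lemma scaleR_eq_single_mult:
  fixes f :: "'a::monoid_add \<Rightarrow>\<^sub>0 real"
  shows "c *\<^sub>R f = Poly_Mapping.single 0 c * f"
proof -
  have "Poly_Mapping.map ((*) c) f = c *\<^sub>R f"
    by (rule poly_mapping_eqI) (simp add: lookup_scaleR Poly_Mapping.map.rep_eq when_def)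
  then show ?thesis
    by (simp add: mult_map_scale_conv_mult)
qed

lemma scaleR_mult_left:
  fixes f g :: "'a::monoid_add \<Rightarrow>\<^sub>0 real"
  shows "(c *\<^sub>R f) * g = c *\<^sub>R (f * g)"
  by (simp add: scaleR_eq_single_mult mult.assoc)

lemma poly_mapping_eq_sum_single:
  assumes "finite S" "Poly_Mapping.keys f \<subseteq> S"
  shows "f = (\<Sum>w\<in>S. Poly_Mapping.single w (Poly_Mapping.lookup f w))"
proof (rule poly_mapping_eqI)
  fix k
  show "Poly_Mapping.lookup f k
      = Poly_Mapping.lookup (\<Sum>w\<in>S. Poly_Mapping.single w (Poly_Mapping.lookup f w)) k"
    using assms by (auto simp: lookup_sum lookup_single when_def in_keys_iff)
qed

text \<open>A scalar acts as multiplication by a multiple of the empty word, and the empty word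
  commutes with every monomial.\<close>

lemma scaleR_mult_right:
  fixes f g :: "'a::monoid_add \<Rightarrow>\<^sub>0 real"
  shows "f * (c *\<^sub>R g) = c *\<^sub>R (f * g)"
proof -
  have comm: "f * Poly_Mapping.single 0 c = Poly_Mapping.single 0 c * f"
    by (subst (1 2) poly_mapping_eq_sum_single[OF finite_keys order_refl, of f])
       (simp add: sum_distrib_left sum_distrib_right mult_single mult.commute)
  show ?thesis
    by (metis comm mult.assoc scaleR_eq_single_mult)
qed

text \<open>A cut just before position \<open>r\<close> leaves \<open>r - Suc s\<close> letters
  between mark \<open>s\<close> and the cut, and \<open>t - r\<close> letters between the cut and
  mark \<open>t\<close>. Over all cuts that separate the two marks, these pairs run through every
  splitting of \<open>t - Suc s\<close>.\<close>

lemma sum_shift_product_eq_1: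
  fixes \<phi> :: "nat \<Rightarrow> real"
  assumes "\<And>n. (\<Sum>a\<le>n. \<phi> a * \<phi> (n - a)) = 1" "s < t"
  shows "(\<Sum>r\<in>{s<..t}. \<phi> (r - Suc s) * \<phi> (t - r)) = 1"
proof -
  have "(\<Sum>r\<in>{s<..t}. \<phi> (r - Suc s) * \<phi> (t - r)) = (\<Sum>a\<le>t - Suc s. \<phi> a * \<phi> (t - Suc s - a))"
    by (rule sum.reindex_bij_witness[of _ "\<lambda>a. a + Suc s" "\<lambda>r. r - Suc s"])
       (use assms(2) in \<open>auto intro!: arg_cong2[of _ _ _ _ "(*)"] arg_cong[of _ _ \<phi>]\<close>)
  then show ?thesis
    by (simp only: assms(1))
qed

lemma ex_convolution_sqrt:
  "\<exists>\<phi> :: nat \<Rightarrow> real. \<phi> 0 = 1 \<and> (\<forall>n. (\<Sum>a\<le>n. \<phi> a * \<phi> (n - a)) = 1)"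
proof -
  let ?\<phi> = "\<lambda>a. (-1) ^ a * ((- 1/2 :: real) gchoose a)"
  have conv: "(\<Sum>a\<le>n. ?\<phi> a * ?\<phi> (n - a)) = 1" for n
  proof -
  have "(\<Sum>a\<le>n. ?\<phi> a * ?\<phi> (n - a))
      = (-1) ^ n * (\<Sum>a\<le>n. ((- 1/2 :: real) gchoose a) * ((- 1/2) gchoose (n - a)))"
    by (simp add: sum_distrib_left)
       (auto intro!: sum.cong simp: algebra_simps simp flip: power_add)
  \<comment> \<open>The Vandermonde convolution adds the exponents -1/2 and -1/2. The exponent -1
    belongs to the geometric series, whose coefficients are 1 up to the sign.\<close>
  also have "\<dots> = (-1) ^ n * ((- 1 :: real) gchoose n)"
    using gbinomial_Vandermonde[of "- 1/2 :: real" "- 1/2" n] by (simp add: atMost_atLeast0)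
  also have "\<dots> = 1"
    by (simp add: gbinomial_minus flip: power_add mult.assoc)
       (simp add: binomial_gbinomial[symmetric] of_nat_gbinomial)
  finally show ?thesis .
  qed
  show ?thesis
    by (rule exI[of _ ?\<phi>], intro conjI allI conv) simp
qed

lemma lookup_nc_transpose: "Poly_Mapping.lookup (nc_transpose p) w = Poly_Mapping.lookup p (rev w)"
  by (simp add: nc_transpose_def map_key.rep_eq)

lemma nc_transpose_sum: "nc_transpose (\<Sum>i\<in>A. f i) = (\<Sum>i\<in>A. nc_transpose (f i))"
  by (rule poly_mapping_eqI) (simp add: lookup_nc_transpose lookup_sum)

lemma nc_transpose_scaleR: "nc_transpose (c *\<^sub>R f) = c *\<^sub>R nc_transpose f"
  by (rule poly_mapping_eqI) (simp add: lookup_nc_transpose lookup_scaleR)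

lemma nc_transpose_single: "nc_transpose (Poly_Mapping.single w c) = Poly_Mapping.single (rev w) c"
  by (rule poly_mapping_eqI) (auto simp: lookup_nc_transpose lookup_single when_def)

abbreviation nc_word :: "'v list \<Rightarrow> 'v ncpoly" where
  "nc_word w \<equiv> Poly_Mapping.single w 1"

lemma nc_word_append: "nc_word u * nc_word w = nc_word (u @ w)"
  by (simp add: mult_single plus_list_def)

lemma nc_one: "1 = nc_word []"
  by (metis single_one zero_list_def)

lemma nc_var_mult_word: "nc_var j * nc_word w = nc_word (j # w)"
  by (simp add: nc_var_def nc_word_append)

subsection \<open>The Hessian as a quadratic expression\<close>

text \<open>\<^term>\<open>hcoeff k w\<close> is the coefficient of \<open>t\<close> to the power \<open>k\<close> in the word \<open>w\<close> evaluated at \<open>x + t h\<close>.\<close>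

fun hcoeff :: "nat \<Rightarrow> 'g list \<Rightarrow> ('g + 'g) ncpoly" where
  "hcoeff 0 [] = 1"
| "hcoeff (Suc k) [] = 0"
| "hcoeff 0 (j # w) = nc_var (Inl j) * hcoeff 0 w"
| "hcoeff (Suc k) (j # w) = nc_var (Inl j) * hcoeff (Suc k) w + nc_var (Inr j) * hcoeff k w"

lemma hcoeff_eq_0: "length w < k \<Longrightarrow> hcoeff k w = 0"
  by (induction k w rule: hcoeff.induct) auto

lemma prod_list_expand:
  assumes "length w \<le> n"
  shows "prod_list (map (\<lambda>j. nc_var (Inl j) + t *\<^sub>R nc_var (Inr j)) w)
       = (\<Sum>k\<le>n. t ^ k *\<^sub>R hcoeff k w)"
  using assms
proof (induction w)
  case Nil
  show ?case
    by (cases n) (simp_all add: sum.atMost_Suc_shift del: sum.atMost_Suc)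
next
  case (Cons j w)
  then obtain m where m: "n = Suc m" "length w \<le> m"
    by (cases n) auto
  let ?x = "nc_var (Inl j) :: ('a + 'a) ncpoly" and ?h = "nc_var (Inr j) :: ('a + 'a) ncpoly"
  \<comment> \<open>The top term vanishes because \<open>w\<close> is shorter than \<open>n\<close>.
    Lowering the bound makes room for the shift of exponents caused by the letter
    \<open>h\<close>.\<close>
  have *: "(\<Sum>k\<le>n. t ^ k *\<^sub>R hcoeff k w) = (\<Sum>k\<le>m. t ^ k *\<^sub>R hcoeff k w)"
    using m by (simp add: hcoeff_eq_0)
  have "(\<Sum>k\<le>n. t ^ k *\<^sub>R hcoeff k (j # w))
      = ?x * (\<Sum>k\<le>n. t ^ k *\<^sub>R hcoeff k w) + t *\<^sub>R (?h * (\<Sum>k\<le>m. t ^ k *\<^sub>R hcoeff k w))"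
    unfolding m(1) sum.atMost_Suc_shift
    by (simp add: sum.distrib sum_distrib_left scaleR_sum_right scaleR_mult_right algebra_simps)
  also have "\<dots> = (?x + t *\<^sub>R ?h) * (\<Sum>k\<le>n. t ^ k *\<^sub>R hcoeff k w)"
    by (simp add: * scaleR_mult_left algebra_simps)
  finally show ?case
    using Cons by simp
qed

lemma vector_derivative_power_sum:
  fixes c :: "nat \<Rightarrow> 'a::real_normed_vector"
  shows "vector_derivative (\<lambda>t. \<Sum>k\<le>n. t ^ k *\<^sub>R c k) (at s)
       = (\<Sum>k<n. s ^ k *\<^sub>R (real (Suc k) *\<^sub>R c (Suc k)))"
proof (rule vector_derivative_at)
  have "((\<lambda>t. t ^ k *\<^sub>R c k) has_vector_derivative (real k * s ^ (k - 1)) *\<^sub>R c k) (at s)" for k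
    by (auto intro!: derivative_eq_intros simp: has_real_derivative_iff_has_vector_derivative[symmetric])
  then have "((\<lambda>t. \<Sum>k\<le>n. t ^ k *\<^sub>R c k) has_vector_derivative
      (\<Sum>k\<le>n. (real k * s ^ (k - 1)) *\<^sub>R c k)) (at s)"
    by (intro has_vector_derivative_sum) auto
  also have "(\<Sum>k\<le>n. (real k * s ^ (k - 1)) *\<^sub>R c k)
      = (\<Sum>k<n. s ^ k *\<^sub>R (real (Suc k) *\<^sub>R c (Suc k)))"
    by (cases n) (auto simp: sum.atMost_Suc_shift lessThan_Suc_atMost algebra_simps
        simp del: sum.atMost_Suc)
  finally show "((\<lambda>t. \<Sum>k\<le>n. t ^ k *\<^sub>R c k) has_vector_derivative
      (\<Sum>k<n. s ^ k *\<^sub>R (real (Suc k) *\<^sub>R c (Suc k)))) (at s)" .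
qed

lemma nc_Hessian_eq:
  "nc_Hessian p = 2 *\<^sub>R (\<Sum>w\<in>Poly_Mapping.keys p. Poly_Mapping.lookup p w *\<^sub>R hcoeff 2 w)"
proof -
  \<comment> \<open>The upper exponent \<open>Suc n\<close> is at least 2, so two differentiations
    leave the non-empty range \<open>k < n\<close> even for constant \<open>p\<close>; at 0 only its
    term \<open>k = 0\<close> survives.\<close>
  define n where "n = Suc (nc_degree p)"
  define c where "c k = (\<Sum>w\<in>Poly_Mapping.keys p. Poly_Mapping.lookup p w *\<^sub>R hcoeff k w)" for k
  have len: "length w \<le> Suc n" if "w \<in> Poly_Mapping.keys p" for w
    using that by (force simp: n_def nc_degree_def intro: le_SucI Max_ge)
  have "nc_subst (\<lambda>j. nc_var (Inl j) + t *\<^sub>R nc_var (Inr j)) p = (\<Sum>k\<le>Suc n. t ^ k *\<^sub>R c k)" for t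
    unfolding nc_subst_def c_def scaleR_sum_right
    by (subst sum.swap) (auto intro!: sum.cong simp: prod_list_expand[OF len] scaleR_sum_right
        mult.commute simp del: sum.atMost_Suc)
  then have "nc_Hessian p = vector_derivative
      (\<lambda>s. \<Sum>k\<le>n. s ^ k *\<^sub>R (real (Suc k) *\<^sub>R c (Suc k))) (at 0)"
    by (simp only: nc_Hessian_def vector_derivative_power_sum lessThan_Suc_atMost)
  also have "\<dots> = 2 *\<^sub>R c 2"
    by (simp only: vector_derivative_power_sum)
       (simp add: n_def sum.lessThan_Suc_shift numeral_2_eq_2 del: sum.lessThan_Suc)
  finally show ?thesis
    by (simp add: c_def)
qed

definition mark :: "'g list \<Rightarrow> nat \<Rightarrow> ('g + 'g) list" where
  "mark w s = (map Inl w)[s := Inr (w ! s)]"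

definition mark2 :: "'g list \<Rightarrow> nat \<Rightarrow> nat \<Rightarrow> ('g + 'g) list" where
  "mark2 w s t = (map Inl w)[s := Inr (w ! s), t := Inr (w ! t)]"

lemma hcoeff_0: "hcoeff 0 w = nc_word (map Inl w)"
  by (induction w) (simp_all add: nc_var_mult_word nc_one)

lemma hcoeff_1: "hcoeff (Suc 0) w = (\<Sum>s<length w. nc_word (mark w s))"
  by (induction w)
     (simp_all add: hcoeff_0 sum.lessThan_Suc_shift sum_distrib_left nc_var_mult_word mark_def
       del: sum.lessThan_Suc)

lemma hcoeff_2: "hcoeff 2 w = (\<Sum>t<length w. \<Sum>s<t. nc_word (mark2 w s t))"
proof (induction w)
  case (Cons j w)
  then show ?case
    by (simp add: numeral_2_eq_2 hcoeff_1 sum.lessThan_Suc_shift sum_distrib_left nc_var_mult_word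
        mark_def mark2_def sum.distrib del: sum.lessThan_Suc)
qed (simp add: numeral_2_eq_2)

lemma mark_append_mark:
  assumes "r \<le> length w" "s < r"
  shows "mark (take r w) s @ mark (drop r w) b = mark2 w s (r + b)"
proof -
  have "map Inl w = map Inl (take r w) @ map Inl (drop r w)"
    by (simp flip: map_append)
  then show ?thesis
    unfolding mark2_def by (rule ssubst) (use assms in \<open>simp add: mark_def list_update_append\<close>)
qed

lemma rev_mark_rev:
  "a < length u \<Longrightarrow> rev (mark (rev u) a) = mark u (length u - Suc a)"
  by (simp add: mark_def rev_update rev_nth rev_map)

text \<open>This is \<open>W\<close> in the overview. The weight depends on the distance of the
  marked letter from the left end of \<open>u\<close>, which is the end at the cut.\<close>

definition weighted_deriv :: "(nat \<Rightarrow> real) \<Rightarrow> 'g list \<Rightarrow> ('g + 'g) ncpoly" where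
  "weighted_deriv \<phi> u = (\<Sum>a<length u. \<phi> a *\<^sub>R nc_word (mark u a))"

text \<open>For a left piece \<open>u\<close> the cut is at the right end, so reversing it makes the
  weights again count the distance from the cut.\<close>

lemma nc_transpose_weighted_deriv:
  "nc_transpose (weighted_deriv \<phi> (rev u)) 
    = (\<Sum>s<length u. \<phi> (length u - Suc s) *\<^sub>R nc_word (mark u s))"
proof -
  have "nc_transpose (weighted_deriv \<phi> (rev u)) 
    = (\<Sum>a<length u. \<phi> a *\<^sub>R nc_word (mark u (length u - Suc a)))"
    by (simp add: weighted_deriv_def nc_transpose_sum nc_transpose_scaleR nc_transpose_single rev_mark_rev)
  also have "\<dots> = (\<Sum>s<length u. \<phi> (length u - Suc s) *\<^sub>R nc_word (mark u s))"
    by (rule sum.reindex_bij_witness[of _ "\<lambda>s. length u - Suc s" "\<lambda>s. length u - Suc s"]) auto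
  finally show ?thesis .
qed

text \<open>Each product, belonging to a cut \<open>r\<close>, marks one position \<open>s\<close>
  to the left and one position \<open>t\<close> to the right of the cut. For a fixed pair of
  positions the weights of the separating cuts add up to 1.\<close>

lemma hcoeff_2_eq_weighted:
  assumes \<phi>: "\<And>n. (\<Sum>a\<le>n. \<phi> a * \<phi> (n - a)) = 1"
  shows "hcoeff 2 w = (\<Sum>r\<in>{0<..<length w}.
      nc_transpose (weighted_deriv \<phi> (rev (take r w))) * weighted_deriv \<phi> (drop r w))"
proof -
  let ?N = "length w"
  let ?f = "\<lambda>r s t. (\<phi> (r - Suc s) * \<phi> (t - r)) *\<^sub>R nc_word (mark2 w s t)"
  have "nc_transpose (weighted_deriv \<phi> (rev (take r w))) * weighted_deriv \<phi> (drop r w)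
      = (\<Sum>t\<in>{r..<?N}. \<Sum>s<r. ?f r s t)" if "r < ?N" for r
  proof -
    have "nc_transpose (weighted_deriv \<phi> (rev (take r w))) * weighted_deriv \<phi> (drop r w)
      = (\<Sum>b<?N - r. \<Sum>s<r. (\<phi> (r - Suc s) * \<phi> b) *\<^sub>R nc_word (mark2 w s (r + b)))"
      unfolding nc_transpose_weighted_deriv
      using that
      by (simp add: weighted_deriv_def sum_distrib_left sum_distrib_right scaleR_mult_left
          scaleR_mult_right scaleR_sum_right nc_word_append mult.commute)
         (auto intro!: sum.cong simp: mark_append_mark)
    also have "\<dots> = (\<Sum>t\<in>{r..<?N}. \<Sum>s<r. ?f r s t)"
      by (rule sum.reindex_bij_witness[of _ "\<lambda>t. t - r" "\<lambda>b. r + b"]) (use that in auto)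
    finally show ?thesis .
  qed
  then have "(\<Sum>r\<in>{0<..<?N}.
      nc_transpose (weighted_deriv \<phi> (rev (take r w))) * weighted_deriv \<phi> (drop r w))
      = (\<Sum>r\<in>{0<..<?N}. \<Sum>t\<in>{r..<?N}. \<Sum>s<r. ?f r s t)"
    by simp
  also have "\<dots> = (\<Sum>(r, t, s)\<in>(SIGMA r:{0<..<?N}. SIGMA t:{r..<?N}. {..<r}). ?f r s t)"
    by (simp add: sum.Sigma)
  \<comment> \<open>The cuts between \<open>s\<close> and \<open>t\<close> are those with
    \<open>s < r\<close> and \<open>r \<le> t\<close>; both pieces are then automatically
    non-empty.\<close>
  also have "\<dots> = (\<Sum>(t, s, r)\<in>(SIGMA t:{..<?N}. SIGMA s:{..<t}. {s<..t}). ?f r s t)"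
    by (rule sum.reindex_bij_witness[of _ "\<lambda>(t, s, r). (r, t, s)" "\<lambda>(r, t, s). (t, s, r)"]) auto
  also have "\<dots> = (\<Sum>t<?N. \<Sum>s<t. \<Sum>r\<in>{s<..t}. ?f r s t)"
    by (simp add: sum.Sigma)
  also have "\<dots> = (\<Sum>t<?N. \<Sum>s<t. nc_word (mark2 w s t))"
    by (auto intro!: sum.cong simp: sum_shift_product_eq_1[OF \<phi>] simp flip: scaleR_sum_left)
  finally show ?thesis
    by (simp add: hcoeff_2)
qed

lemma finite_nonempty_words: "finite {u :: 'g::finite list. u \<noteq> [] \<and> length u < d}"
  by (rule finite_subset[OF _ finite_lists_length_le[of UNIV d]]) auto

text \<open>Cutting a word and rejoining the pieces are inverse to each other. The degree bound
  makes both non-empty pieces shorter than \<open>d\<close>, and pairs whose rejoined word is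
  missing from \<open>p\<close> have coefficient 0.\<close>

lemma sum_split_words:
  fixes p :: "'g::finite ncpoly" and F :: "'g list \<Rightarrow> 'g list \<Rightarrow> 'a::real_vector"
  assumes "nc_degree p \<le> d"
  defines "S \<equiv> {u. u \<noteq> [] \<and> length u < d}"
  shows "(\<Sum>w\<in>Poly_Mapping.keys p. \<Sum>r\<in>{0<..<length w}.
           Poly_Mapping.lookup p w *\<^sub>R F (rev (take r w)) (drop r w))
       = (\<Sum>u\<in>S. \<Sum>u'\<in>S. Poly_Mapping.lookup p (rev u @ u') *\<^sub>R F u u')"
proof -
  have fin: "finite S"
    unfolding S_def by (rule finite_nonempty_words)
  have len: "length w \<le> d" if "w \<in> Poly_Mapping.keys p" for w
    using that assms(1) by (auto simp: nc_degree_def)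
  have "(\<Sum>u\<in>S. \<Sum>u'\<in>S. Poly_Mapping.lookup p (rev u @ u') *\<^sub>R F u u')
      = (\<Sum>(u, u')\<in>S \<times> S. Poly_Mapping.lookup p (rev u @ u') *\<^sub>R F u u')"
    by (simp add: sum.cartesian_product)
  also have "\<dots> = (\<Sum>(u, u')\<in>{(u, u'). u \<in> S \<and> u' \<in> S \<and> rev u @ u' \<in> Poly_Mapping.keys p}. 
      Poly_Mapping.lookup p (rev u @ u') *\<^sub>R F u u')"
    using fin by (intro sum.mono_neutral_right) (auto simp: in_keys_iff)
  also have "\<dots> = (\<Sum>(w, r)\<in>(SIGMA w:Poly_Mapping.keys p. {0<..<length w}).
      Poly_Mapping.lookup p w *\<^sub>R F (rev (take r w)) (drop r w))"
    by (rule sum.reindex_bij_witness[of _ "\<lambda>(w, r). (rev (take r w), drop r w)" 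
          "\<lambda>(u, u'). (rev u @ u', length u)"])
       (use len in \<open>force simp: S_def\<close>)+
  finally show ?thesis
    by (simp add: sum.Sigma)
qed

lemma nc_Hessian_eq_weighted:
  fixes p :: "'g::finite ncpoly"
  assumes \<phi>: "\<And>n. (\<Sum>a\<le>n. \<phi> a * \<phi> (n - a)) = 1" and "nc_degree p \<le> d"
  defines "S \<equiv> {u. u \<noteq> [] \<and> length u < d}"
  shows "nc_Hessian p = (\<Sum>u\<in>S. \<Sum>u'\<in>S. (2 * Poly_Mapping.lookup p (rev u @ u')) *\<^sub>R
           (nc_transpose (weighted_deriv \<phi> u) * weighted_deriv \<phi> u'))"
proof -
  have "nc_Hessian p = 2 *\<^sub>R (\<Sum>w\<in>Poly_Mapping.keys p. \<Sum>r\<in>{0<..<length w}.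
      Poly_Mapping.lookup p w *\<^sub>R (nc_transpose (weighted_deriv \<phi> (rev (take r w)))
        * weighted_deriv \<phi> (drop r w)))"
    by (simp add: nc_Hessian_eq hcoeff_2_eq_weighted[OF \<phi>] scaleR_sum_right)
  also have "\<dots> = 2 *\<^sub>R (\<Sum>u\<in>S. \<Sum>u'\<in>S. Poly_Mapping.lookup p (rev u @ u') *\<^sub>R
      (nc_transpose (weighted_deriv \<phi> u) * weighted_deriv \<phi> u'))"
    unfolding S_def by (subst sum_split_words[OF assms(2)]) simp
  finally show ?thesis
    by (simp add: scaleR_sum_right)
qed

subsection \<open>Evaluation on matrices\<close>

lemma word_eval_simps [simp]:
  "word_eval A [] = mat 1" "word_eval A (j # w) = A j ** word_eval A w"
  by (simp_all add: word_eval_def)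

lemma word_eval_append: "word_eval A (u @ w) = word_eval A u ** word_eval A w"
  by (induction u) (simp_all add: matrix_mul_assoc)

lemma word_eval_rev:
  assumes "\<And>j. transpose (A j) = A j"
  shows "word_eval A (rev w) = transpose (word_eval A w)"
  by (induction w) (simp_all add: word_eval_append matrix_transpose_mul assms)

lemma nc_eval_superset:
  assumes "finite S" "Poly_Mapping.keys f \<subseteq> S"
  shows "nc_eval A f = (\<Sum>w\<in>S. Poly_Mapping.lookup f w *\<^sub>R word_eval A w)"
  unfolding nc_eval_def using assms
  by (intro sum.mono_neutral_left) (auto simp: in_keys_iff)

lemma linear_nc_eval: "linear (nc_eval A)"
proof (rule linearI)
  fix f g :: "'a ncpoly" and c :: real
  let ?S = "Poly_Mapping.keys f \<union> Poly_Mapping.keys g"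
  have "nc_eval A (f + g) = (\<Sum>w\<in>?S. Poly_Mapping.lookup (f + g) w *\<^sub>R word_eval A w)"
    by (rule nc_eval_superset) (simp_all add: keys_add)
  also have "\<dots> = nc_eval A f + nc_eval A g"
    using nc_eval_superset[of ?S f A] nc_eval_superset[of ?S g A]
    by (simp add: lookup_add scaleR_add_left sum.distrib)
  finally show "nc_eval A (f + g) = nc_eval A f + nc_eval A g" .
  have "nc_eval A (c *\<^sub>R f) = (\<Sum>w\<in>Poly_Mapping.keys f. Poly_Mapping.lookup (c *\<^sub>R f) w *\<^sub>R word_eval A w)"
    by (rule nc_eval_superset) (auto simp: in_keys_iff lookup_scaleR)
  then show "nc_eval A (c *\<^sub>R f) = c *\<^sub>R nc_eval A f"
    by (simp add: lookup_scaleR nc_eval_def scaleR_sum_right)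
qed

lemma nc_eval_single: "nc_eval A (Poly_Mapping.single w c) = c *\<^sub>R word_eval A w"
  by (subst nc_eval_superset[of "{w}"]) auto

lemma linear_matrix_apply: "linear (\<lambda>M :: real^'n^'m. M *v x)"
  by (rule linearI) (simp_all add: matrix_vector_mult_add_rdistrib scaleR_matrix_vector_assoc)

lemma nc_eval_apply:
  "nc_eval A f *v x = (\<Sum>w\<in>Poly_Mapping.keys f. Poly_Mapping.lookup f w *\<^sub>R (word_eval A w *v x))"
  by (simp add: nc_eval_def linear_sum[OF linear_matrix_apply] scaleR_matrix_vector_assoc)

lemma nc_eval_mult_apply: "nc_eval A (f * g) *v x = nc_eval A f *v (nc_eval A g *v x)"
proof -
  have "f * g = (\<Sum>u\<in>Poly_Mapping.keys f. \<Sum>w\<in>Poly_Mapping.keys g. 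
      Poly_Mapping.single (u @ w) (Poly_Mapping.lookup f u * Poly_Mapping.lookup g w))"
    by (subst poly_mapping_eq_sum_single[OF finite_keys order_refl, of f],
        subst poly_mapping_eq_sum_single[OF finite_keys order_refl, of g])
       (simp add: sum_distrib_left sum_distrib_right mult_single plus_list_def, rule sum.swap)
  then have "nc_eval A (f * g) = (\<Sum>u\<in>Poly_Mapping.keys f. \<Sum>w\<in>Poly_Mapping.keys g.
      (Poly_Mapping.lookup f u * Poly_Mapping.lookup g w) *\<^sub>R (word_eval A u ** word_eval A w))"
    by (simp add: linear_sum[OF linear_nc_eval] nc_eval_single word_eval_append)
  then have "nc_eval A (f * g) *v x = (\<Sum>u\<in>Poly_Mapping.keys f. \<Sum>w\<in>Poly_Mapping.keys g.
      (Poly_Mapping.lookup f u * Poly_Mapping.lookup g w) *\<^sub>R (word_eval A u *v (word_eval A w *v x)))"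
    by (simp add: linear_sum[OF linear_matrix_apply] matrix_vector_mul_assoc
        flip: scaleR_matrix_vector_assoc)
  also have "\<dots> = (\<Sum>u\<in>Poly_Mapping.keys f. Poly_Mapping.lookup f u *\<^sub>R (word_eval A u *v
      (\<Sum>w\<in>Poly_Mapping.keys g. Poly_Mapping.lookup g w *\<^sub>R (word_eval A w *v x))))"
    by (simp add: linear_sum[OF matrix_vector_mul_linear] linear_scale[OF matrix_vector_mul_linear]
        scaleR_sum_right)
  also have "\<dots> = nc_eval A f *v (nc_eval A g *v x)"
    by (simp only: nc_eval_apply)
  finally show ?thesis .
qed

lemma nc_eval_transpose:
  assumes "\<And>j. transpose (A j) = A j"
  shows "nc_eval A (nc_transpose f) = transpose (nc_eval A f)"
proof -
  have *: "linear (transpose :: real^'n^'n \<Rightarrow> _)"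
    by (rule linearI) (simp_all add: transpose_def vec_eq_iff)
  have "nc_eval A (nc_transpose f) = (\<Sum>w\<in>Poly_Mapping.keys f. Poly_Mapping.lookup f w *\<^sub>R word_eval A (rev w))"
    by (subst poly_mapping_eq_sum_single[OF finite_keys order_refl, of f])
       (simp add: nc_transpose_sum nc_transpose_single linear_sum[OF linear_nc_eval] nc_eval_single)
  then show ?thesis
    by (simp add: nc_eval_def linear_sum[OF *] linear_scale[OF *] word_eval_rev[OF assms])
qed

text \<open>At a symmetric tuple the involution becomes matrix transposition, which moves one factor
  across the inner product.\<close>

lemma nc_eval_square:
  assumes "\<And>j. transpose (A j) = A j"
  shows "(nc_eval A (nc_transpose f * f) *v x) \<bullet> x = (norm (nc_eval A f *v x))\<^sup>2"
  by (simp add: nc_eval_mult_apply nc_eval_transpose[OF assms] power2_norm_eq_inner dot_lmul_matrix)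

text \<open>The bracketing isolates the matrix of a block of the border vector: the letter is
  \<open>u ! a\<close> and the word is \<open>drop (Suc a) u\<close>.\<close>

lemma word_eval_mark:
  assumes "a < length u"
  shows "word_eval (case_sum X H) (mark u a) =
    word_eval X (take a u) ** (H (u ! a) ** word_eval X (drop (Suc a) u))"
proof -
  have Inl: "word_eval (case_sum X H) (map Inl w) = word_eval X w" for w
    by (induction w) simp_all
  show ?thesis
    using assms
    by (simp add: mark_def upd_conv_take_nth_drop take_map drop_map word_eval_append Inl)
qed

lemma is_SDS_of_finite:
  assumes "finite P" "finite N"
    and "f = (\<Sum>i\<in>P. nc_transpose (g i) * g i) - (\<Sum>i\<in>N. nc_transpose (g i) * g i)"
  shows "is_SDS f (card P) (card N)"
proof -
  obtain a b where ab: "bij_betw a {..<card P} P" "bij_betw b {..<card N} N"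
    using assms(1,2) by (metis ex_bij_betw_nat_finite atLeast0LessThan)
  show ?thesis
    unfolding is_SDS_def
    by (rule exI[of _ "g \<circ> a"], rule exI[of _ "g \<circ> b"])
       (simp add: assms(3) flip: sum.reindex_bij_betw[OF ab(1)] sum.reindex_bij_betw[OF ab(2)])
qed

subsection \<open>The border vector\<close>

lemma finite_border_index: "finite (border_index d :: ('g::finite \<times> 'g list) set)"
proof -
  have "border_index d \<subseteq> UNIV \<times> {m :: 'g list. set m \<subseteq> UNIV \<and> length m \<le> d}"
    by (auto simp: border_index_def)
  then show ?thesis
    by (rule finite_subset) (intro finite_cartesian_product finite_lists_length_le finite)
qed

lemma lookup_border_vector:
  "Poly_Mapping.lookup (border_vector d X H v) (j, m) =
     (if length m + 2 \<le> d then H $ j *v (word_eval (($) X) m *v v) else 0)"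
proof -
  have "Poly_Mapping.lookup (border_vector d X H v) (j, m)
      = (\<Sum>jm\<in>border_index d. if jm = (j, m) then H $ j *v (word_eval (($) X) m *v v) else 0)"
    unfolding border_vector_def lookup_sum
    by (rule sum.cong) (auto simp: lookup_single when_def split: if_splits)
  then show ?thesis
    by (simp add: finite_border_index) (simp add: border_index_def)
qed

lemma linear_border_vector: "linear (\<lambda>H. border_vector d X H v)"
proof (rule linearI; rule poly_mapping_eqI)
  fix H H' r k
  show "Poly_Mapping.lookup (border_vector d X (H + H') v) k
    = Poly_Mapping.lookup (border_vector d X H v + border_vector d X H' v) k"
    by (cases k) (simp add: lookup_border_vector lookup_add matrix_vector_mult_add_rdistrib)
  show "Poly_Mapping.lookup (border_vector d X (r *\<^sub>R H) v) k
    = Poly_Mapping.lookup (r *\<^sub>R border_vector d X H v) k"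
    by (cases k) (simp add: lookup_border_vector lookup_scaleR scaleR_matrix_vector_assoc)
qed

text \<open>A non-empty word is \<open>j # m\<close>, so these words correspond to the indices
  \<open>(j, m)\<close> of the border vector; \<open>i\<close> is the length of
  \<open>m\<close>.\<close>

lemma card_nonempty_words:
  "card {u :: 'g::finite list. u \<noteq> [] \<and> length u < d} = CARD('g) * (\<Sum>i | i + 2 \<le> d. CARD('g) ^ i)"
proof -
  have fin: "finite {i. i + 2 \<le> d}"
    by (rule finite_subset[of _ "{..d}"]) auto
  have words: "finite {u :: 'g list. length u = n}" "card {u :: 'g list. length u = n} = CARD('g) ^ n" for n
    using finite_lists_length_eq[of "UNIV :: 'g set" n] card_lists_length_eq[of "UNIV :: 'g set" n] by simp_all
  have "u \<noteq> [] \<and> length u < d \<longleftrightarrow> (\<exists>i. i + 2 \<le> d \<and> length u = Suc i)" for u :: "'g list"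
    by (cases u) auto
  then have "{u :: 'g list. u \<noteq> [] \<and> length u < d} = (\<Union>i\<in>{i. i + 2 \<le> d}. {u. length u = Suc i})"
    by blast
  also have "card \<dots> = (\<Sum>i | i + 2 \<le> d. card {u :: 'g list. length u = Suc i})"
    using fin words(1) by (intro card_UN_disjoint) auto
  finally show ?thesis
    by (simp add: words(2) sum_distrib_left)
qed

text \<open>
  Sends the border vector to the vector of all \<^term>\<open>weighted_deriv \<phi> u\<close> evaluated on matrices. It is
  unitriangular with respect to word length.
\<close>

definition border_shift ::
  "(nat \<Rightarrow> real) \<Rightarrow> 'g list set \<Rightarrow> (real^'n^'n)^'g \<Rightarrow> ('g \<times> 'g list \<Rightarrow>\<^sub>0 real^'n) \<Rightarrow> ('g list \<Rightarrow>\<^sub>0 real^'n)" where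
  "border_shift \<phi> S X b = (\<Sum>u\<in>S. Poly_Mapping.single u
     (\<Sum>a<length u. \<phi> a *\<^sub>R (word_eval (($) X) (take a u) *v Poly_Mapping.lookup b (u ! a, drop (Suc a) u))))"

lemma lookup_border_shift:
  assumes "finite S"
  shows "Poly_Mapping.lookup (border_shift \<phi> S X b) u = (if u \<in> S then
    (\<Sum>a<length u. \<phi> a *\<^sub>R (word_eval (($) X) (take a u) *v Poly_Mapping.lookup b (u ! a, drop (Suc a) u))) else 0)"
  using assms by (simp add: border_shift_def lookup_sum lookup_single when_def)

lemma linear_border_shift:
  assumes "finite S"
  shows "linear (border_shift \<phi> S X)"
  by (rule linearI; rule poly_mapping_eqI)
     (simp_all add: lookup_border_shift[OF assms] lookup_add lookup_scaleR
       matrix_vector_right_distrib matrix_vector_mult_scaleR scaleR_add_right sum.distrib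
       scaleR_sum_right mult.commute)

text \<open>At the word \<open>j # m\<close> the term \<open>a = 0\<close> is the block
  \<open>(j, m)\<close> of \<open>b\<close> itself, and all other terms involve blocks with words
  shorter than \<open>m\<close>. Induction on the length therefore kills every block.\<close>

lemma border_shift_eq_0D:
  assumes "finite S" "\<phi> 0 = 1" "border_shift \<phi> S X b = 0" "\<And>j m. j # m \<notin> S \<Longrightarrow> Poly_Mapping.lookup b (j, m) = 0"
  shows "b = 0"
proof -
  have "Poly_Mapping.lookup b (j, m) = 0" for j m
  proof (induction m arbitrary: j rule: length_induct)
    case (1 m)
    show ?case
    proof (cases "j # m \<in> S")
      case True
      have "0 = Poly_Mapping.lookup (border_shift \<phi> S X b) (j # m)"
        by (simp add: assms(3))
      also have "\<dots> = Poly_Mapping.lookup b (j, m)"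
        using True 1 assms(2)
        by (simp add: lookup_border_shift[OF assms(1)] sum.lessThan_Suc_shift del: sum.lessThan_Suc)
      finally show ?thesis by simp
    qed (use assms(4) in simp)
  qed
  then show ?thesis
    by (intro poly_mapping_eqI) auto
qed

lemma lookup_border_shift_border_vector:
  fixes X H :: "(real^'n^'n)^'g::finite"
  assumes "u \<in> S" "S = {u. u \<noteq> [] \<and> length u < d}" "finite S"
  shows "Poly_Mapping.lookup (border_shift \<phi> S X (border_vector d X H v)) u
    = nc_eval (case_sum (($) X) (($) H)) (weighted_deriv \<phi> u) *v v"
proof -
  \<comment> \<open>At least one letter is dropped from a word shorter than \<open>d\<close>, so the
    default value 0 outside \<open>border_index d\<close> is never read.\<close>
  have "length (drop (Suc a) u) + 2 \<le> d" if "a < length u" for a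
    using that assms(1,2) by auto
  then show ?thesis
    using assms(1)
    by (simp add: lookup_border_shift[OF assms(3)] lookup_border_vector weighted_deriv_def
        linear_sum[OF linear_nc_eval] linear_scale[OF linear_nc_eval] nc_eval_single
        linear_sum[OF linear_matrix_apply] word_eval_mark matrix_vector_mul_assoc matrix_mul_assoc
        del: length_drop flip: scaleR_matrix_vector_assoc)
qed

subsection \<open>Dual families and signed diagonalization\<close>

context
  fixes \<psi> :: "'i \<Rightarrow> 'a::real_vector \<Rightarrow> real" and z :: "'i \<Rightarrow> 'a" and I :: "'i set" and c :: "'i \<Rightarrow> real"
  assumes fin: "finite I" and lin: "\<And>i. i \<in> I \<Longrightarrow> linear (\<psi> i)"
    and dual: "\<And>i j. i \<in> I \<Longrightarrow> j \<in> I \<Longrightarrow> \<psi> i (z j) = (if i = j then c i else 0)"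
    and nz: "\<And>i. i \<in> I \<Longrightarrow> c i \<noteq> 0"
begin

lemma inj_on_if_dual: "inj_on z I"
  using dual nz by (metis inj_onI)

lemma dual_sum: 
  assumes "i \<in> I"
  shows "\<psi> i (\<Sum>j\<in>I. r j *\<^sub>R z j) = r i * c i"
proof -
  have "\<psi> i (\<Sum>j\<in>I. r j *\<^sub>R z j) = (\<Sum>j\<in>I. r j * \<psi> i (z j))"
    using lin[OF assms] by (simp add: linear_sum linear_scale)
  also have "\<dots> = (\<Sum>j\<in>I. if i = j then r j * c i else 0)"
    using assms by (auto intro!: sum.cong simp: dual)
  finally show ?thesis
    using fin assms by simp
qed

text \<open>Applying \<open>\<psi> i\<close> to a linear combination isolates its coefficient at
  \<open>i\<close>, up to the non-zero factor \<open>c i\<close>.\<close>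

lemma independent_if_dual: "independent (z ` I)"
proof (rule real_vector.independent_if_scalars_zero)
  fix f x assume "(\<Sum>x\<in>z ` I. f x *\<^sub>R x) = 0" "x \<in> z ` I"
  then obtain i where "i \<in> I" "x = z i" "(\<Sum>j\<in>I. f (z j) *\<^sub>R z j) = 0"
    using inj_on_if_dual by (auto simp: sum.reindex)
  then show "f x = 0"
    using dual_sum[of i "\<lambda>j. f (z j)"] nz[of i] linear_0[OF lin, of i] by simp
qed (use fin in simp)

lemma eq_0_if_dual:
  assumes "x \<in> span (z ` I)" "\<And>i. i \<in> I \<Longrightarrow> \<psi> i x = 0"
  shows "x = 0"
proof -
  obtain f where "x = (\<Sum>y\<in>z ` I. f y *\<^sub>R y)"
    using assms(1) fin by (auto simp: real_vector.span_finite)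
  then have x: "x = (\<Sum>j\<in>I. f (z j) *\<^sub>R z j)"
    using inj_on_if_dual by (simp add: sum.reindex)
  have "f (z i) = 0" if "i \<in> I" for i
    using dual_sum[OF that, of "\<lambda>j. f (z j)"] assms(2)[OF that] nz[OF that] x by simp
  then show ?thesis
    by (simp add: x)
qed

end

text \<open>If the spans met only in 0, the union of \<open>B\<close> and \<open>C\<close> would be
  an independent set too large for the span of \<open>T\<close>. The set \<open>T\<close> replaces
  an ambient dimension, as the whole space may be infinite-dimensional.\<close>

lemma ex_common_nonzero_in_spans:
  fixes B C T :: "'a::real_vector set"
  assumes B: "independent B" "B \<subseteq> span T" and C: "independent C" "C \<subseteq> span T"
    and T: "finite T" "card T < card B + card C"
  shows "\<exists>x. x \<noteq> 0 \<and> x \<in> span B \<and> x \<in> span C"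
proof (rule ccontr)
  assume "\<not> ?thesis"
  then have disj: "x = 0" if "x \<in> span B" "x \<in> span C" for x
    using that by blast
  have fin: "finite B" "finite C"
    using real_vector.independent_span_bound T(1) B C by blast+
  have BC: "B \<inter> C = {}"
    using disj B(1) real_vector.dependent_zero by (metis disjoint_iff span_base)
  have "independent (B \<union> C)"
  proof (rule real_vector.independent_if_scalars_zero)
    fix f x assume sum: "(\<Sum>x\<in>B \<union> C. f x *\<^sub>R x) = 0" and x: "x \<in> B \<union> C"
    let ?b = "\<Sum>x\<in>B. f x *\<^sub>R x" and ?c = "\<Sum>x\<in>C. f x *\<^sub>R x"
    have "?b + ?c = 0"
      using sum fin BC by (simp add: sum.union_disjoint)
    then have bc: "?b = - ?c"
      by (simp add: eq_neg_iff_add_eq_0)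
    have b: "?b \<in> span B" and c: "?c \<in> span C"
      by (auto intro: span_sum span_scale span_base)
    have "?b = 0"
      using b c by (intro disj) (simp_all add: bc span_neg)
    moreover from this have "?c = 0"
      using bc by simp
    ultimately show "f x = 0"
      using x real_vector.independentD[OF B(1) fin(1) order_refl, of f x]
        real_vector.independentD[OF C(1) fin(2) order_refl, of f x] by blast
  qed (use fin in simp)
  then have "card (B \<union> C) \<le> card T"
    using real_vector.independent_span_bound T(1) B(2) C(2) by blast
  then show False
    using T(2) fin BC by (simp add: card_Un_disjoint)
qed

text \<open>
  A signed-orthonormal family of maximal size captures the whole form: if the remainder did not
  vanish, polarization would produce a further vector of non-zero square orthogonal to the family.
\<close>

lemma ex_signed_orthonormal_family:
  fixes B :: "'a::real_vector \<Rightarrow> 'a \<Rightarrow> real"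
  assumes lin: "\<And>x. linear (B x)" and sym: "\<And>x y. B x y = B y x" and "finite F"
  obtains m :: nat and \<epsilon> :: "nat \<Rightarrow> real" and z :: "nat \<Rightarrow> 'a"
  where "\<And>i. i < m \<Longrightarrow> \<epsilon> i = 1 \<or> \<epsilon> i = -1"
    and "\<And>i j. i < m \<Longrightarrow> j < m \<Longrightarrow> B (z i) (z j) = (if i = j then \<epsilon> i else 0)"
    and "\<And>x y. x \<in> span F \<Longrightarrow> y \<in> span F \<Longrightarrow> B x y = (\<Sum>i<m. \<epsilon> i * (B (z i) x * B (z i) y))"
proof -
  define orth where "orth m z \<longleftrightarrow> (\<forall>i<m. z i \<in> span F \<and> \<bar>B (z i) (z i)\<bar> = 1) \<and>
    (\<forall>i<m. \<forall>j<m. i \<noteq> j \<longrightarrow> B (z i) (z j) = 0)" for m :: nat and z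
  have bound: "m \<le> card F" if o: "orth m z" for m z
  proof -
    have "independent (z ` {..<m})"
      by (rule independent_if_dual[of _ "\<lambda>i. B (z i)" _ "\<lambda>i. B (z i) (z i)"])
         (use o in \<open>auto simp: orth_def lin\<close>)
    moreover have "inj_on z {..<m}"
      by (rule inj_on_if_dual[of _ "\<lambda>i. B (z i)" _ "\<lambda>i. B (z i) (z i)"])
         (use o in \<open>auto simp: orth_def lin\<close>)
    moreover have "z ` {..<m} \<subseteq> span F"
      using o by (auto simp: orth_def)
    ultimately show ?thesis
      using real_vector.independent_span_bound[OF assms(3), of "z ` {..<m}"] by (simp add: card_image)
  qed
  have "orth 0 (\<lambda>_. 0)"
    by (simp add: orth_def)
  \<comment> \<open>The empty family qualifies, and independence bounds the size by
    \<open>card F\<close>, so a maximal size exists.\<close>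
  then have "\<exists>m. (\<exists>z. orth m z) \<and> (\<forall>m'. (\<exists>z. orth m' z) \<longrightarrow> m' \<le> m)"
    using ex_has_greatest_nat[of "\<lambda>m. \<exists>z. orth m z" 0 id "Suc (card F)"] bound
    by (fastforce simp: less_Suc_eq_le)
  then obtain m where "\<exists>z. orth m z" and max: "\<And>m' z. orth m' z \<Longrightarrow> m' \<le> m"
    by blast
  then obtain z where z: "orth m z" by blast
  define \<epsilon> where "\<epsilon> i = B (z i) (z i)" for i
  have \<epsilon>: "\<epsilon> i = 1 \<or> \<epsilon> i = -1" if "i < m" for i
    using z that by (auto simp: orth_def \<epsilon>_def abs_if split: if_splits)
  have zz: "B (z i) (z j) = (if i = j then \<epsilon> i else 0)" if "i < m" "j < m" for i j
    using z that by (auto simp: orth_def \<epsilon>_def)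
  have span_z: "z i \<in> span F" if "i < m" for i
    using z that by (auto simp: orth_def)
  \<comment> \<open>This subtracts the component along the family; \<open>\<epsilon> i\<close> is
    its own inverse and so serves as the normalizing factor.\<close>
  define \<pi> where "\<pi> x = x - (\<Sum>i<m. (\<epsilon> i * B (z i) x) *\<^sub>R z i)" for x
  have lin2: "B x (y - y') = B x y - B x y'" "B x (y + y') = B x y + B x y'"
    "B x (r *\<^sub>R y) = r * B x y" "B x (\<Sum>i\<in>A. f i) = (\<Sum>i\<in>A. B x (f i))" 
    for x y y' r and f :: "nat \<Rightarrow> 'a" and A
    using lin[of x] by (simp_all add: linear_diff linear_add linear_scale linear_sum)
  have lin1: "B (y + y') x = B y x + B y' x" "B (r *\<^sub>R y) x = r * B y x" for x y y' r
    by (simp_all add: lin2 sym[of _ x])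
  have \<pi>_orth: "B (z i) (\<pi> x) = 0" if "i < m" for i x
  proof -
    have "(\<Sum>j<m. \<epsilon> j * B (z j) x * B (z i) (z j)) = (\<Sum>j<m. if i = j then \<epsilon> j * B (z j) x * \<epsilon> j else 0)"
      by (rule sum.cong) (use that in \<open>auto simp: zz\<close>)
    also have "\<dots> = B (z i) x"
      using that \<epsilon>[OF that] by auto
    finally show ?thesis
      by (simp add: \<pi>_def lin2)
  qed
  \<comment> \<open>The form on the remainders is exactly the error in the desired expansion of
    \<open>B\<close>.\<close>
  have \<pi>_\<pi>: "B (\<pi> x) (\<pi> y) = B x y - (\<Sum>i<m. \<epsilon> i * (B (z i) x * B (z i) y))" for x y
  proof -
    have "B (\<pi> x) (\<pi> y) = B (\<pi> x) y"
      by (subst (2) \<pi>_def) (simp add: lin2 sym[of "\<pi> x" "z i" for i] \<pi>_orth)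
    also have "\<dots> = B y x - (\<Sum>i<m. \<epsilon> i * B (z i) x * B (z i) y)"
      unfolding sym[of _ y] by (simp add: \<pi>_def lin2 sym[of y "z i" for i])
    finally show ?thesis
      by (simp add: sym[of y] mult.assoc)
  qed
  have null: "B w w = 0" if w: "w \<in> span F" "\<And>i. i < m \<Longrightarrow> B (z i) w = 0" for w
  proof (rule ccontr)
    assume "B w w \<noteq> 0"
    \<comment> \<open>Rescaled to square 1 or -1, the vector would enlarge the maximal
      family.\<close>
    define w' where "w' = (1 / sqrt \<bar>B w w\<bar>) *\<^sub>R w"
    have "\<bar>B w' w'\<bar> = 1"
      using \<open>B w w \<noteq> 0\<close> by (simp add: w'_def lin1 lin2 abs_mult flip: real_sqrt_mult)
    moreover have "w' \<in> span F" "\<And>i. i < m \<Longrightarrow> B (z i) w' = 0" "\<And>i. i < m \<Longrightarrow> B w' (z i) = 0"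
      using w by (auto simp: w'_def span_scale lin1 lin2 sym[of w "z i" for i])
    ultimately have "orth (Suc m) (z(m := w'))"
      using z by (auto simp: orth_def less_Suc_eq)
    from max[OF this] show False by simp
  qed
  have \<pi>_span: "\<pi> x \<in> span F" if "x \<in> span F" for x
    unfolding \<pi>_def using that span_z by (intro span_diff span_sum span_scale) auto
  have "B x y = (\<Sum>i<m. \<epsilon> i * (B (z i) x * B (z i) y))" if "x \<in> span F" "y \<in> span F" for x y
  proof -
    have "B w w = 0" if "w \<in> {\<pi> x, \<pi> y, \<pi> x + \<pi> y}" for w
      by (rule null) (use that \<pi>_span[OF \<open>x \<in> span F\<close>] \<pi>_span[OF \<open>y \<in> span F\<close>] in
        \<open>auto simp: \<pi>_orth lin2 intro: span_add\<close>)
    from this[of "\<pi> x"] this[of "\<pi> y"] this[of "\<pi> x + \<pi> y"]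
    have "B (\<pi> x) (\<pi> y) = 0"
      using sym[of "\<pi> x" "\<pi> y"] by (simp add: lin1 lin2)
    then show ?thesis
      by (simp add: \<pi>_\<pi>)
  qed
  with \<epsilon> zz show ?thesis
    using that by blast
qed

text \<open>\<open>Q\<close> becomes a bilinear form on finitely supported vectors. Each
  \<open>l i\<close> lists the values of the functional \<open>B (z i)\<close> on the unit vectors,
  so pairing it with the coordinates of \<open>z j\<close> gives
  \<open>B (z i) (z j)\<close>.\<close>

lemma ex_signed_diagonalization:
  fixes Q :: "'i \<Rightarrow> 'i \<Rightarrow> real"
  assumes "finite S" and sym: "\<And>u u'. Q u u' = Q u' u"
  obtains m :: nat and \<epsilon> :: "nat \<Rightarrow> real" and l z :: "nat \<Rightarrow> 'i \<Rightarrow> real"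
  where "\<And>i. i < m \<Longrightarrow> \<epsilon> i = 1 \<or> \<epsilon> i = -1"
    and "\<And>i j. i < m \<Longrightarrow> j < m \<Longrightarrow> (\<Sum>u\<in>S. l i u * z j u) = (if i = j then \<epsilon> i else 0)"
    and "\<And>u u'. u \<in> S \<Longrightarrow> u' \<in> S \<Longrightarrow> Q u u' = (\<Sum>i<m. \<epsilon> i * (l i u * l i u'))"
proof -
  define B :: "('i \<Rightarrow>\<^sub>0 real) \<Rightarrow> ('i \<Rightarrow>\<^sub>0 real) \<Rightarrow> real" where
    "B x y = (\<Sum>u\<in>S. (\<Sum>u'\<in>S. Q u u' * Poly_Mapping.lookup x u') * Poly_Mapping.lookup y u)" for x y
  let ?e = "\<lambda>u. Poly_Mapping.single u 1 :: 'i \<Rightarrow>\<^sub>0 real"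
  have lin: "linear (B x)" for x
    by (rule linearI)
       (simp_all add: B_def lookup_add lookup_scaleR algebra_simps sum.distrib sum_distrib_left)
  have symB: "B x y = B y x" for x y
    unfolding B_def sum_distrib_right by (subst sum.swap) (simp add: sym mult_ac)
  have B_e: "B x (?e u) = (\<Sum>u'\<in>S. Q u u' * Poly_Mapping.lookup x u')" if "u \<in> S" for x u
    using that assms(1) by (simp add: B_def lookup_single when_def if_distrib cong: if_cong)
  have B_sum: "B x y = (\<Sum>u\<in>S. B x (?e u) * Poly_Mapping.lookup y u)" for x y
    by (simp add: B_e B_def[of x y])
  have Q: "Q u u' = B (?e u) (?e u')" if "u \<in> S" "u' \<in> S" for u u'
    using that assms(1) sym[of u u'] by (simp add: B_e lookup_single when_def if_distrib cong: if_cong)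
  obtain m :: nat and \<epsilon> :: "nat \<Rightarrow> real" and z :: "nat \<Rightarrow> 'i \<Rightarrow>\<^sub>0 real"
    where "\<And>i. i < m \<Longrightarrow> \<epsilon> i = 1 \<or> \<epsilon> i = -1"
    and "\<And>i j. i < m \<Longrightarrow> j < m \<Longrightarrow> B (z i) (z j) = (if i = j then \<epsilon> i else 0)"
    and "\<And>x y. x \<in> span (?e ` S) \<Longrightarrow> y \<in> span (?e ` S)
      \<Longrightarrow> B x y = (\<Sum>i<m. \<epsilon> i * (B (z i) x * B (z i) y))"
  proof (rule ex_signed_orthonormal_family[where B = B, OF lin symB finite_imageI[OF assms(1), of ?e]], goal_cases)
    case 1
    show ?case
      by (rule 1(1)[OF 1(2-)])
  qed
  then show ?thesis
    by (intro that[of m \<epsilon> "\<lambda>i u. B (z i) (?e u)" "\<lambda>i. Poly_Mapping.lookup (z i)"])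
       (simp_all add: Q span_base flip: B_sum)
qed

subsection \<open>Counting negative squares\<close>

text \<open>The signed diagonalization of \<open>Q\<close> is substituted into the exact formula for
  the Hessian. The dual vectors \<open>z\<close> are kept for the later dimension count.\<close>

lemma nc_Hessian_signed_squares:
  fixes p :: "'g::finite ncpoly" and d :: nat
  assumes "nc_symmetric p" "nc_degree p \<le> d"
    and \<phi>: "\<And>n. (\<Sum>a\<le>n. \<phi> a * \<phi> (n - a)) = 1"
  defines "S \<equiv> {u. u \<noteq> [] \<and> length u < d}"
  obtains m :: nat and \<epsilon> :: "nat \<Rightarrow> real" and l z :: "nat \<Rightarrow> 'g list \<Rightarrow> real"
  where "\<And>i. i < m \<Longrightarrow> \<epsilon> i = 1 \<or> \<epsilon> i = -1"
    and "\<And>i j. i < m \<Longrightarrow> j < m \<Longrightarrow> (\<Sum>u\<in>S. l i u * z j u) = (if i = j then \<epsilon> i else 0)"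
    and "nc_Hessian p = (\<Sum>i<m. \<epsilon> i *\<^sub>R
      (nc_transpose (\<Sum>u\<in>S. l i u *\<^sub>R weighted_deriv \<phi> u) * (\<Sum>u\<in>S. l i u *\<^sub>R weighted_deriv \<phi> u)))"
proof -
  let ?W = "weighted_deriv \<phi> :: 'g list \<Rightarrow> _"
  define Q where "Q u u' = 2 * Poly_Mapping.lookup p (rev u @ u')" for u u'
  have fin: "finite S"
    unfolding S_def by (rule finite_nonempty_words)
  have "Poly_Mapping.lookup p (rev w) = Poly_Mapping.lookup p w" for w
    using assms(1) by (simp add: nc_symmetric_def flip: lookup_nc_transpose)
  \<comment> \<open>Reversing \<open>rev u @ u'\<close> gives \<open>rev u' @ u\<close>, so symmetry
    of \<open>p\<close> is symmetry of \<open>Q\<close>.\<close>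
  from this[of "rev _ @ _"] have sym: "Q u u' = Q u' u" for u u'
    by (simp add: Q_def)
  obtain m :: nat and \<epsilon> :: "nat \<Rightarrow> real" and l z :: "nat \<Rightarrow> 'g list \<Rightarrow> real" where *: "\<And>i. i < m \<Longrightarrow> \<epsilon> i = 1 \<or> \<epsilon> i = -1"
    "\<And>i j. i < m \<Longrightarrow> j < m \<Longrightarrow> (\<Sum>u\<in>S. l i u * z j u) = (if i = j then \<epsilon> i else 0)"
    and Q: "\<And>u u'. u \<in> S \<Longrightarrow> u' \<in> S \<Longrightarrow> Q u u' = (\<Sum>i<m. \<epsilon> i * (l i u * l i u'))"
  proof (rule ex_signed_diagonalization[where Q = Q, OF fin sym], goal_cases)
    case 1
    show ?case
      by (rule 1(1)[OF 1(2-)])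
  qed
  have "nc_Hessian p = (\<Sum>u\<in>S. \<Sum>u'\<in>S. Q u u' *\<^sub>R (nc_transpose (?W u) * ?W u'))"
    unfolding S_def Q_def by (rule nc_Hessian_eq_weighted[OF \<phi> assms(2)])
  also have "\<dots> = (\<Sum>u\<in>S. \<Sum>u'\<in>S. \<Sum>i<m. (\<epsilon> i * (l i u * l i u')) *\<^sub>R (nc_transpose (?W u) * ?W u'))"
    by (simp add: Q scaleR_sum_left)
  also have "\<dots> = (\<Sum>i<m. \<Sum>u\<in>S. \<Sum>u'\<in>S. (\<epsilon> i * (l i u * l i u')) *\<^sub>R (nc_transpose (?W u) * ?W u'))"
    by (subst sum.swap[of _ "{..<m}"], subst (2) sum.swap) simp
  also have "\<dots> = (\<Sum>i<m. \<epsilon> i *\<^sub>R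
      (nc_transpose (\<Sum>u\<in>S. l i u *\<^sub>R ?W u) * (\<Sum>u\<in>S. l i u *\<^sub>R ?W u)))"
    by (simp add: nc_transpose_sum nc_transpose_scaleR sum_product scaleR_mult_left scaleR_mult_right
        scaleR_sum_right mult_ac)
  finally have hess: "nc_Hessian p = \<dots>" .
  show ?thesis
    by (rule that[OF * hess])
qed

lemma span_block_basis:
  fixes y :: "'i \<Rightarrow>\<^sub>0 real^'n"
  assumes "finite S" "\<And>u. u \<notin> S \<Longrightarrow> Poly_Mapping.lookup y u = 0"
  shows "y \<in> span ((\<lambda>(u, a). Poly_Mapping.single u (axis a 1)) ` (S \<times> UNIV))"
proof -
  have "y = (\<Sum>u\<in>S. \<Sum>a\<in>UNIV. (Poly_Mapping.lookup y u $ a) *\<^sub>R Poly_Mapping.single u (axis a 1))"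
  proof (rule poly_mapping_eqI)
    fix k
    have "(\<Sum>u\<in>S. \<Sum>a\<in>UNIV. (Poly_Mapping.lookup y u $ a) *\<^sub>R (axis a 1 when u = k))
        = (\<Sum>u\<in>S. if u = k then \<Sum>a\<in>UNIV. (Poly_Mapping.lookup y k $ a) *\<^sub>R axis a 1 else 0)"
      by (rule sum.cong) (auto simp: when_def)
    also have "\<dots> = Poly_Mapping.lookup y k"
      using assms by (simp add: basis_expansion scalar_mult_eq_scaleR[symmetric])
    finally show "Poly_Mapping.lookup y k = Poly_Mapping.lookup
        (\<Sum>u\<in>S. \<Sum>a\<in>UNIV. (Poly_Mapping.lookup y u $ a) *\<^sub>R Poly_Mapping.single u (axis a 1)) k"
      by (simp add: lookup_sum lookup_scaleR lookup_single)
  qed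
  also have "\<dots> \<in> span ((\<lambda>(u, a). Poly_Mapping.single u (axis a 1)) ` (S \<times> UNIV))"
    by (intro span_sum span_scale span_base) auto
  finally show ?thesis .
qed

text \<open>The vectors \<open>z j\<close> with \<open>j\<close> in \<open>N\<close>, tensored with
  the coordinate vectors, span a space of dimension \<open>card N * CARD('n)\<close>. It is too
  large to meet \<open>U\<close> only in 0. On it the maps \<open>\<L> j\<close> with
  \<open>j\<close> outside \<open>N\<close> vanish, while those with index in \<open>N\<close>
  separate points.\<close>

lemma ex_common_dual_family:
  fixes U :: "('i \<Rightarrow>\<^sub>0 real^'n) set" and l z :: "nat \<Rightarrow> 'i \<Rightarrow> real"
  assumes "finite S" "subspace U" and U: "\<And>y u. y \<in> U \<Longrightarrow> u \<notin> S \<Longrightarrow> Poly_Mapping.lookup y u = 0"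
    and dual: "\<And>i j. i < m \<Longrightarrow> j < m \<Longrightarrow> (\<Sum>u\<in>S. l i u * z j u) = (if i = j then \<epsilon> i else 0)"
    and N: "N \<subseteq> {..<m}" and nz: "\<And>i. i \<in> N \<Longrightarrow> \<epsilon> i \<noteq> 0"
    and dim: "card S * CARD('n) < dim U + card N * CARD('n)"
  defines "\<L> \<equiv> \<lambda>i y. \<Sum>u\<in>S. l i u *\<^sub>R Poly_Mapping.lookup y u :: real^'n"
  obtains y i where "y \<in> U" "i \<in> N" "\<L> i y \<noteq> 0" "\<And>j. j < m \<Longrightarrow> j \<notin> N \<Longrightarrow> \<L> j y = 0"
proof -
  define zc :: "nat \<Rightarrow> 'n \<Rightarrow> 'i \<Rightarrow>\<^sub>0 real^'n" where
    "zc j a = (\<Sum>u\<in>S. Poly_Mapping.single u (z j u *\<^sub>R axis a 1))" for j a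
  let ?C = "(\<lambda>(j, a). zc j a) ` (N \<times> UNIV)"
  let ?T = "(\<lambda>(u, a). Poly_Mapping.single u (axis a 1)) ` (S \<times> UNIV) :: ('i \<Rightarrow>\<^sub>0 real^'n) set"
  have lin: "linear (\<L> i)" for i
    by (rule linearI)
       (simp_all add: \<L>_def lookup_add lookup_scaleR scaleR_add_right sum.distrib scaleR_sum_right mult.commute)
  have lookup_zc: "Poly_Mapping.lookup (zc j a) u = (if u \<in> S then z j u *\<^sub>R axis a 1 else 0)" for j a u
    using assms(1) by (simp add: zc_def lookup_sum lookup_single when_def)
  have \<L>_zc: "\<L> i (zc j a) = (if i = j then \<epsilon> i else 0) *\<^sub>R axis a 1" if "i < m" "j < m" for i j a
    using dual[OF that] by (simp add: \<L>_def lookup_zc flip: scaleR_sum_left)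
  have finN: "finite N"
    using N finite_subset by blast
  note fam = finite_cartesian_product[OF finN finite[of "UNIV :: 'n set"]]
  have flin: "linear (case ia of (i, a) \<Rightarrow> \<lambda>y. \<L> i y $ a)" for ia
    using lin by (cases ia) (auto intro!: linearI simp: linear_add linear_scale)
  have fdual: "(case ia of (i, a) \<Rightarrow> \<lambda>y. \<L> i y $ a) (case jb of (j, b) \<Rightarrow> zc j b)
      = (if ia = jb then \<epsilon> (fst ia) else 0)" if "ia \<in> N \<times> UNIV" "jb \<in> N \<times> UNIV" for ia jb
    using that N by (auto simp: \<L>_zc axis_def subset_iff split: if_splits)
  have fnz: "\<epsilon> (fst ia) \<noteq> 0" if "ia \<in> N \<times> (UNIV :: 'n set)" for ia
    using that nz by auto
  have indC: "independent ?C"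
    by (rule independent_if_dual[OF fam flin fdual fnz])
  have cardC: "card ?C = card N * CARD('n)"
    using inj_on_if_dual[OF fam flin fdual fnz] by (simp add: card_image card_cartesian_product)
  obtain B where B: "B \<subseteq> U" "independent B" "U \<subseteq> span B" "card B = dim U"
    using real_vector.basis_exists by blast
  have "card ?T \<le> card (S \<times> (UNIV :: 'n set))"
    by (rule card_image_le) (use assms(1) in simp)
  then have "card ?T < card B + card ?C"
    using dim cardC B(4) by (simp add: card_cartesian_product)
  moreover have "B \<subseteq> span ?T" "?C \<subseteq> span ?T"
    using B(1) U assms(1) by (auto intro!: span_block_basis simp: lookup_zc)
  ultimately obtain y where y: "y \<noteq> 0" "y \<in> span B" "y \<in> span ?C"
    using ex_common_nonzero_in_spans[OF B(2) _ indC, of ?T] assms(1) by auto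
  have "\<exists>i\<in>N. \<L> i y \<noteq> 0"
  proof (rule ccontr)
    assume "\<not> ?thesis"
    then have "y = 0"
      by (intro eq_0_if_dual[OF fam flin fdual fnz y(3)]) auto
    with y(1) show False by simp
  qed
  moreover have "\<L> j y = 0" if "j < m" "j \<notin> N" for j
    by (rule linear_eq_0_on_span[OF lin _ y(3)]) (use that N in \<open>auto simp: \<L>_zc subset_iff\<close>)
  moreover have "y \<in> U"
    using y(2) B(1) assms(2) span_minimal by blast
  ultimately show ?thesis
    using that by blast
qed

theorem theorem1p7:
  fixes p :: "'g::finite ncpoly"
    and d \<nu> k :: nat
    and X :: "(real^'n^'n)^'g"
    and v :: "real^'n"
    and \<H> :: "((real^'n^'n)^'g) set"
  assumes "nc_symmetric p"
    and "nc_degree p = d"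
    and "\<nu> = (\<Sum>i | i + 2 \<le> d. CARD('g) ^ i)"
    and "k \<ge> 1"
    and "X \<in> sym_tuples"
    and "subspace \<H>" and "\<H> \<subseteq> sym_tuples"
    and "int (CARD('n) * CARD('g) * \<nu>) - int (dim {border_vector d X H v | H. H \<in> \<H>})
           \<le> int k * int CARD('n) - 1"
    and "Hessian_positive_rel p \<H> X v"
  shows "sigma_minus_min (nc_Hessian p) < k"
proof (rule ccontr)
  assume contra: "\<not> sigma_minus_min (nc_Hessian p) < k"
  define S where "S = {u :: 'g list. u \<noteq> [] \<and> length u < d}"
  have finS: "finite S"
    unfolding S_def by (rule finite_nonempty_words)
  obtain \<phi> :: "nat \<Rightarrow> real" where \<phi>0: "\<phi> 0 = 1" and \<phi>: "\<And>n. (\<Sum>a\<le>n. \<phi> a * \<phi> (n - a)) = 1"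
    using ex_convolution_sqrt by blast
  obtain m :: nat and \<epsilon> :: "nat \<Rightarrow> real" and l z :: "nat \<Rightarrow> 'g list \<Rightarrow> real"
    where \<epsilon>: "\<And>i. i < m \<Longrightarrow> \<epsilon> i = 1 \<or> \<epsilon> i = -1"
    and dual: "\<And>i j. i < m \<Longrightarrow> j < m \<Longrightarrow> (\<Sum>u\<in>S. l i u * z j u) = (if i = j then \<epsilon> i else 0)"
    and hess: "nc_Hessian p = (\<Sum>i<m. \<epsilon> i *\<^sub>R
      (nc_transpose (\<Sum>u\<in>S. l i u *\<^sub>R weighted_deriv \<phi> u) * (\<Sum>u\<in>S. l i u *\<^sub>R weighted_deriv \<phi> u)))"
    unfolding S_def
  proof (rule nc_Hessian_signed_squares[where \<phi> = \<phi>, OF assms(1) eq_imp_le[OF assms(2)] \<phi>], goal_cases)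
    case 1
    show ?case
      by (rule 1(1)[OF 1(2-)])
  qed
  define f where "f i = (\<Sum>u\<in>S. l i u *\<^sub>R weighted_deriv \<phi> u)" for i
  define N where "N = {i. i < m \<and> \<epsilon> i = -1}"
  define P where "P = {..<m} - N"
  have P: "\<epsilon> i = 1" if "i \<in> P" for i
    using \<epsilon> that by (auto simp: N_def P_def)
  have N: "N \<subseteq> {..<m}"
    by (auto simp: N_def)
  have split: "(\<Sum>i<m. \<epsilon> i *\<^sub>R F i) = (\<Sum>i\<in>P. F i) - (\<Sum>i\<in>N. F i)" for F :: "nat \<Rightarrow> 'x::real_vector"
  proof -
    have "(\<Sum>i<m. \<epsilon> i *\<^sub>R F i) = (\<Sum>i\<in>P. \<epsilon> i *\<^sub>R F i) + (\<Sum>i\<in>N. \<epsilon> i *\<^sub>R F i)"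
      unfolding P_def by (rule sum.subset_diff[OF N]) simp
    then show ?thesis
      by (simp add: P N_def sum_negf)
  qed
  have "is_SDS (nc_Hessian p) (card P) (card N)"
    using N by (intro is_SDS_of_finite[where g = f]) 
      (auto simp: P_def[symmetric] hess split simp flip: f_def intro: finite_subset, simp add: P_def)
  \<comment> \<open>The diagonalization is itself a representation as signed squares, so the minimum
    is at most \<open>card N\<close>.\<close>
  then have kN: "k \<le> card N"
    using contra Least_le[of "\<lambda>s. \<exists>r. is_SDS (nc_Hessian p) r s" "card N"]
    by (fastforce simp: sigma_minus_min_def)
  define L where "L = border_shift \<phi> S X"
  define U where "U = {border_vector d X H v | H. H \<in> \<H>}"
  have linL: "linear L"
    unfolding L_def by (rule linear_border_shift[OF finS])
  have "U = (\<lambda>H. border_vector d X H v) ` \<H>"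
    by (auto simp: U_def)
  then have subU: "subspace U"
    using linear_subspace_image[OF linear_border_vector assms(6)] by simp
  \<comment> \<open>A vector in \<open>U\<close> has blocks only at indices \<open>(j, m)\<close>
    with \<open>length m + 2 \<le> d\<close>, that is, with \<open>j # m\<close> in
    \<open>S\<close>. This is the support condition under which the unitriangular map is
    injective.\<close>
  have "b = 0" if "b \<in> U" "L b = 0" for b
    by (rule border_shift_eq_0D[where \<phi> = \<phi> and S = S and X = X])
       (use that finS \<phi>0 in \<open>auto simp: L_def U_def S_def lookup_border_vector\<close>)
  then have injL: "inj_on L (span U)"
    using subU linL by (simp add: linear_inj_on_iff_eq_0 span_eq_iff[THEN iffD2])
  have dimL: "dim (L ` U) = dim U"
  proof -
    obtain B where B: "B \<subseteq> U" "independent B" "U \<subseteq> span B" "card B = dim U"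
      using real_vector.basis_exists by blast
    have "span B = span U"
      using B(1,3) by (simp add: span_eq span_superset subset_trans[OF B(1) span_superset])
    then have "independent (L ` B)" "inj_on L B"
      using linear_independent_injective_image[OF linL B(2)] injL span_superset[of B]
      by (auto intro: inj_on_subset)
    moreover have "span (L ` B) = span (L ` U)"
      using \<open>span B = span U\<close> by (simp add: linear_span_image[OF linL])
    ultimately have "dim (L ` U) = card (L ` B)"
      using real_vector.dim_eq_card by metis
    then show ?thesis
      using \<open>inj_on L B\<close> B(4) by (simp add: card_image)
  qed
  have "card S = CARD('g) * \<nu>"
    unfolding S_def assms(3) by (rule card_nonempty_words)
  \<comment> \<open>The summand -1 in the codimension bound yields the strict inequality.\<close>
  then have "int (card S * CARD('n)) < int (dim U) + int k * int CARD('n)"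
    using assms(8) by (simp add: U_def mult_ac)
  also have "\<dots> \<le> int (dim (L ` U) + card N * CARD('n))"
    using kN by (simp add: dimL flip: of_nat_mult)
  finally have dim: "card S * CARD('n) < dim (L ` U) + card N * CARD('n)"
    by linarith
  have supp: "Poly_Mapping.lookup y u = 0" if "y \<in> L ` U" "u \<notin> S" for y u
    using that by (auto simp: L_def lookup_border_shift[OF finS])
  have nz: "\<epsilon> i \<noteq> 0" if "i \<in> N" for i
    using that by (simp add: N_def)
  obtain y i where "y \<in> L ` U" and i: "i \<in> N" "(\<Sum>u\<in>S. l i u *\<^sub>R Poly_Mapping.lookup y u) \<noteq> 0"
    and P0: "\<And>j. j < m \<Longrightarrow> j \<notin> N \<Longrightarrow> (\<Sum>u\<in>S. l j u *\<^sub>R Poly_Mapping.lookup y u) = 0"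
  proof (rule ex_common_dual_family[where l = l, OF finS linear_subspace_image[OF linL subU] supp dual N nz dim], assumption+, goal_cases)
    case 1
    show ?case
      by (rule 1(1)[OF 1(2-)])
  qed
  then obtain H where H: "H \<in> \<H>" "y = L (border_vector d X H v)"
    by (auto simp: U_def)
  let ?A = "case_sum (($) X) (($) H)"
  have symA: "transpose (?A j) = ?A j" for j
    using assms(5,7) H(1) by (cases j) (auto simp: sym_tuples_def)
  have eval: "nc_eval ?A (f j) *v v = (\<Sum>u\<in>S. l j u *\<^sub>R Poly_Mapping.lookup y u)" for j
    by (simp add: f_def H(2) L_def lookup_border_shift_border_vector[OF _ S_def finS]
        linear_sum[OF linear_nc_eval] linear_scale[OF linear_nc_eval] linear_sum[OF linear_matrix_apply]
        flip: scaleR_matrix_vector_assoc)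
  have "(nc_eval ?A (nc_Hessian p) *v v) \<bullet> v = (\<Sum>j<m. \<epsilon> j *\<^sub>R (norm (nc_eval ?A (f j) *v v))\<^sup>2)"
    by (simp add: hess linear_sum[OF linear_nc_eval] linear_scale[OF linear_nc_eval]
        linear_sum[OF linear_matrix_apply] inner_sum_left nc_eval_square[OF symA] 
        flip: f_def scaleR_matrix_vector_assoc)
  \<comment> \<open>For this \<open>H\<close> all positive squares vanish at \<open>v\<close>, and
    the negative square with index \<open>i\<close> does not.\<close>
  also have "\<dots> = - (\<Sum>j\<in>N. (norm (nc_eval ?A (f j) *v v))\<^sup>2)"
    unfolding split using P0 by (simp add: eval P_def)
  also have "\<dots> < 0"
    using i N by (auto intro!: sum_pos2[of N i] finite_subset[OF N] simp: eval)
  finally show False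
    using assms(9) H(1) by (auto simp: Hessian_positive_rel_def)
qed

end
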